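(* Fix $p\ge0$, and let $\mathbf{A}\in\mathbb{R}^{n\times n}$ be a nonzero positive semidefinite matrix. Let $(I,J)$ denote the pair returned by the $p$th-power rejection sampling algorithm described in the context on inputs $\mathbf{A}$ and $p$. For all $i,j\in\{1,\dots,n\}$, $$\Pr[I=i,\,J=j]=\frac{|\mathbf{A}_{ij}|^p}{\sum_{k,\ell=1}^n|\mathbf{A}_{k\ell}|^p}.$$ In turn, $\Pr[I=i]=\dfrac{\|\mathbf{A}_{*,i}\|_p^p}{\sum_{k=1}^n\|\mathbf{A}_{*,k}\|_p^p}$ and $\Pr[J=j]=\dfrac{\|\mathbf{A}_{*,j}\|_p^p}{\sum_{k=1}^n\|\mathbf{A}_{*,k}\|_p^p}$. The algorithm requires $2n$ entry queries and $O(n)$ arithmetic operations in expectation. Moreover, with probability $1-\delta$, the algorithm terminates using at most $n+\lceil n\log(1/\delta)\rceil$ entry accesses and $O(n\log(1/\delta))$ arithmetic operations.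
   Context: For $\mathbf{x}\in\mathbb{R}^n$ and $p\in[0,\infty)$, $\|\mathbf{x}\|_p^p=\sum_{i=1}^n|\mathbf{x}_i|^p$. $\mathbf{A}_{*,i}$ is the $i$th column of $\mathbf{A}$. A positive semidefinite matrix is a real symmetric matrix with $\mathbf{x}^\top\mathbf{A}\mathbf{x}\ge0$ for all $\mathbf{x}$. Here $\delta\in(0,1)$ is a failure probability. Algorithm. (1) Read the diagonal of $\mathbf{A}$ and define the distribution $\mathcal{D}_p(i)=\mathbf{A}_{ii}^{p/2}/\sum_{k=1}^n\mathbf{A}_{kk}^{p/2}$ for $i\in\{1,\dots,n\}$. (2) Repeat until a pair is returned: sample independent $I,J\sim\mathcal{D}_p$, and with probability $|\mathbf{A}_{IJ}|^p/(\mathbf{A}_{II}\mathbf{A}_{JJ})^{p/2}$ return $(I,J)$. Cost accounting: reading the diagonal takes $n$ entry queries; each round uses one additional entry query and a constant number of arithmetic operations.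
   Formalization: The expected 2n entry queries are proved as an upper bound (equality can fail), and since O(n log(1/δ)) operations fails as δ→1, it is proved as O(n(1+log(1/δ))) for all δ in (0,1) and as O(n log(1/δ)) for δ at most any fixed δ₀<1. *)

theory Defs
  imports "HOL-Probability.SPMF" "Jordan_Normal_Form.Matrix"
begin

text \<open>Matrix and vector indices run over \<open>0, \<dots>, n - 1\<close>.  Powers are \<open>powr\<close>, so
  \<open>0 powr 0 = 0\<close>: for \<open>p = 0\<close> the sums below count nonzero entries.\<close>

definition psd_mat :: "nat \<Rightarrow> real mat \<Rightarrow> bool" where
  "psd_mat n A \<longleftrightarrow> A \<in> carrier_mat n n \<and> transpose_mat A = A \<and>
     (\<forall>x \<in> carrier_vec n. 0 \<le> scalar_prod x (A *\<^sub>v x))"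

definition lp_power :: "real \<Rightarrow> real vec \<Rightarrow> real" where
  "lp_power p x = (\<Sum>i<dim_vec x. \<bar>vec_index x i\<bar> powr p)"

text \<open>The distribution \<open>\<D>\<^sub>p\<close>, computed from the list \<open>d\<close> of diagonal entries.  The weights form a
  probability mass function whenever the entries are nonnegative and not all zero, as for
  the diagonal of a nonzero positive semidefinite matrix; \<open>embed_pmf\<close> is unspecified
  otherwise.\<close>

definition diag_pmf :: "real \<Rightarrow> real list \<Rightarrow> nat pmf" where
  "diag_pmf p d = embed_pmf (\<lambda>i. if i < length d
     then (d ! i) powr (p / 2) / (\<Sum>k<length d. (d ! k) powr (p / 2)) else 0)"

text \<open>A terminated run: the returned pair \<open>(I, J)\<close>, the number of entry queries, and the number of
  arithmetic operations.\<close>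

datatype run = Run (run_I: nat) (run_J: nat) (run_queries: nat) (run_ops: nat)

text \<open>The rejection rounds, with \<open>q\<close> queries and \<open>t\<close> operations already spent.  The matrix is only
  accessed through \<open>entry\<close>, once per round; a round costs \<open>c\<close> arithmetic operations.
  As a least fixed point in the subprobability monad, any probability of running
  forever shows up as missing mass.  (\<open>bernoulli_pmf\<close> truncates its parameter to \<open>[0, 1]\<close>; for a
  positive semidefinite matrix the parameter already lies there, by Cauchy-Schwarz.)\<close>

partial_function (spmf) rejection_rounds ::
  "nat \<Rightarrow> (nat \<Rightarrow> nat \<Rightarrow> real) \<Rightarrow> real \<Rightarrow> real list \<Rightarrow> nat \<Rightarrow> nat \<Rightarrow> run spmf" where
  "rejection_rounds c entry p d q t =
     bind_spmf (spmf_of_pmf (diag_pmf p d)) (\<lambda>i.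
     bind_spmf (spmf_of_pmf (diag_pmf p d)) (\<lambda>j.
     bind_spmf (spmf_of_pmf (bernoulli_pmf
         (\<bar>entry i j\<bar> powr p / ((d ! i) * (d ! j)) powr (p / 2)))) (\<lambda>accept.
     if accept then return_spmf (Run i j (q + 1) (t + c))
     else rejection_rounds c entry p d (q + 1) (t + c))))"

text \<open>Reading the diagonal takes one query per entry; reading it and preparing \<open>\<D>\<^sub>p\<close> for sampling
  costs \<open>s\<close> arithmetic operations per diagonal entry.\<close>

definition rejection_sampler :: "nat \<Rightarrow> nat \<Rightarrow> real mat \<Rightarrow> real \<Rightarrow> run spmf" where
  "rejection_sampler s c A p =
     (let d = map (\<lambda>i. A $$ (i, i)) [0..<dim_row A]
      in rejection_rounds c (\<lambda>i j. A $$ (i, j)) p d (length d) (s * length d))"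

end

(* Let a be the acceptance probability of one round. The number of rejected rounds is geometric with
   parameter a and independent of the returned pair, which is distributed like an accepted pair of a
   single round; as |A_ij|^p <= (A_ii A_jj)^(p/2), the latter distribution is proportional to |A_ij|^p.
   With S the sum of the A_kk^(p/2) and W the sum of the |A_kl|^p one finds a = W / S^2, and
   S^2 <= n * (sum of the A_kk^p) <= n W by Cauchy-Schwarz, hence a >= 1/n. This bounds the expected
   number of rounds by n and the probability of more than m rounds by (1 - 1/n)^m <= exp(-m/n). *)
theory Submission
  imports Defs
begin

section \<open>Rejection loops as subprobability distributions\<close>

lemma spmf_eqI_lossless_le:
  assumes "\<And>x. spmf p x \<le> spmf q x" and "lossless_spmf p"
  shows "p = q"
proof (rule spmf_eqI, rule antisym)
  fix x
  have "ord_spmf (=) p q"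
    using assms(1) by (rule ord_pmf_increaseI) auto
  then have le: "measure (measure_spmf p) X \<le> measure (measure_spmf q) X" for X
    using ord_spmf_eqD_emeasure[of p q X] by (simp add: measure_spmf.emeasure_eq_measure)
  \<comment> \<open>Off \<open>x\<close>, \<open>q\<close> has at least the mass of
    \<open>p\<close>, and its total mass is at most 1, the total of \<open>p\<close>. Hence it has
    no more mass left at \<open>x\<close> than \<open>p\<close> has.\<close>
  have "spmf q x = weight_spmf q - measure (measure_spmf q) (UNIV - {x})"
    using measure_spmf.finite_measure_compl[of "{x}" q] by (simp add: spmf_conv_measure_spmf space_measure_spmf)
  also have "\<dots> \<le> weight_spmf p - measure (measure_spmf p) (UNIV - {x})"
    using le[of "UNIV - {x}"] weight_spmf_le_1[of q] assms(2) by (simp add: lossless_spmf_def)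
  also have "\<dots> = spmf p x"
    using measure_spmf.finite_measure_compl[of "{x}" p] by (simp add: spmf_conv_measure_spmf space_measure_spmf)
  finally show "spmf q x \<le> spmf p x" .
qed (rule assms(1))

lemma mult_pmf_le_pmf_bind: "pmf p x * pmf (f x) y \<le> pmf (bind_pmf p f) y"
proof -
  have "pmf p x * pmf (f x) y = (\<integral>z. pmf (f x) y * indicator {x} z \<partial>measure_pmf p)"
    by (simp add: measure_pmf_single)
  also have "\<dots> \<le> (\<integral>z. pmf (f z) y \<partial>measure_pmf p)"
    by (intro integral_mono measure_pmf.integrable_const_bound[where B = 1])
       (auto simp: pmf_le_1 AE_measure_pmf_iff split: split_indicator)
  finally show ?thesis
    by (simp add: pmf_bind)
qed

text \<open>A single path of execution already has this probability: \<open>None\<close> in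
  \<open>k\<close> successive rounds, then \<open>Some x\<close>. Other paths may lead to the same
  outcome, so only an inequality is claimed. Only the recursion equation enters, not the leastness
  of the fixed point.\<close>

lemma rejection_loop_lower:
  fixes F :: "nat \<Rightarrow> 'a spmf" and C :: "'b spmf"
  assumes step: "\<And>k. F k = bind_pmf C (\<lambda>r. case r of None \<Rightarrow> F (Suc k) | Some x \<Rightarrow> return_spmf (g k x))"
  shows "(1 - weight_spmf C) ^ k * spmf C x \<le> spmf (F m) (g (m + k) x)"
proof (induction k arbitrary: m)
  case 0
  show ?case
    using mult_pmf_le_pmf_bind[of C "Some x"
        "\<lambda>r. case r of None \<Rightarrow> F (Suc m) | Some x \<Rightarrow> return_spmf (g m x)" "Some (g m x)"]
    by (subst step) simp
next
  case (Suc k)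
  have "(1 - weight_spmf C) ^ Suc k * spmf C x \<le> pmf C None * spmf (F (Suc m)) (g (m + Suc k) x)"
    using mult_left_mono[OF Suc.IH[of "Suc m"] pmf_nonneg[of C None]]
    by (simp add: pmf_None_eq_weight_spmf mult.assoc)
  also have "\<dots> \<le> spmf (F m) (g (m + Suc k) x)"
    by (subst (2) step) (rule mult_pmf_le_pmf_bind[of C None, THEN order_trans[rotated]], simp)
  finally show ?case .
qed

text \<open>The pairs (round, value) exhaust the outcomes with total mass 1, so the lower bounds on their
  probabilities are equalities.\<close>

lemma rejection_loop_eq:
  fixes F :: "nat \<Rightarrow> 'a spmf" and C :: "'b spmf"
  assumes step: "\<And>k. F k = bind_pmf C (\<lambda>r. case r of None \<Rightarrow> F (Suc k) | Some x \<Rightarrow> return_spmf (g k x))"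
    and inj: "inj (\<lambda>(k, x). g k x)" and pos: "0 < weight_spmf C"
  shows "F 0 = map_spmf (\<lambda>(k, x). g k x)
    (pair_spmf (spmf_of_pmf (geometric_pmf (weight_spmf C))) (scale_spmf (inverse (weight_spmf C)) C))"
    (is "_ = map_spmf ?g ?P")
proof (rule sym, rule spmf_eqI_lossless_le)
  have w: "weight_spmf C \<in> {0<..1}"
    using pos by (simp add: weight_spmf_le_1)
  \<comment> \<open>No mass is missing on this side, so the lower bound for \<open>F 0\<close>
    leaves no room. Almost sure termination of the loop comes out as a by-product.\<close>
  show "lossless_spmf (map_spmf ?g ?P)"
    using pos by (simp add: lossless_spmf_def weight_scale_spmf)
  show "spmf (map_spmf ?g ?P) y \<le> spmf (F 0) y" for y
  proof (cases "y \<in> range ?g")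
    case True
    then obtain k x where y: "y = ?g (k, x)"
      by auto
    have "spmf (map_spmf ?g ?P) y = spmf ?P (k, x)"
      unfolding y using inj by (rule spmf_map_inj')
    \<comment> \<open>The success factor \<open>weight_spmf C\<close> of the geometric law cancels
      the normalisation of \<open>C\<close>.\<close>
    also have "\<dots> = (1 - weight_spmf C) ^ k * spmf C x"
      using w by (simp add: spmf_scale_spmf)
    also have "\<dots> \<le> spmf (F 0) y"
      using rejection_loop_lower[where F = F and g = g and C = C and k = k and x = x and m = 0, OF step] by (simp add: y)
    finally show ?thesis .
  next
    case False
    then have "spmf (map_spmf ?g ?P) y = 0"
      by (intro spmf_map_outside) auto
    then show ?thesis
      by simp
  qed
qed

section \<open>Tail and mean of the geometric distribution\<close>

lemma measure_geometric_pmf_lessThan: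
  assumes "a \<in> {0<..1}"
  shows "measure (measure_pmf (geometric_pmf a)) {..<m} = 1 - (1 - a) ^ m"
  using assms
  by (induction m) (auto simp: measure_measure_pmf_finite algebra_simps)

text \<open>Here \<open>u\<close> is the cost of the setup and \<open>v\<close> that of a round. As
  \<open>k\<close> counts rejections only, the accepting round adds 1, and the mean number of rounds
  is 1 / a.\<close>

lemma nn_integral_geometric_pmf:
  assumes "a \<in> {0<..1}"
  and "0 \<le> u" "0 \<le> v"
  shows "(\<integral>\<^sup>+ k. ennreal (u + v * (real k + 1)) \<partial>measure_pmf (geometric_pmf a)) = ennreal (u + v / a)"
proof -
  note int = integrable_real_geometric_pmf[OF assms(1)]
  have "(\<integral>\<^sup>+ k. ennreal (u + v * (real k + 1)) \<partial>measure_pmf (geometric_pmf a))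
      = ennreal (\<integral>k. u + v * (real k + 1) \<partial>measure_pmf (geometric_pmf a))"
    using int assms by (intro nn_integral_eq_integral) auto
  also have "(\<integral>k. u + v * (real k + 1) \<partial>measure_pmf (geometric_pmf a)) = u + v * ((1 - a) / a + 1)"
    using int by (simp add: expectation_geometric_pmf[OF assms(1)])
  also have "\<dots> = u + v / a"
    using assms by (simp add: field_simps)
  finally show ?thesis .
qed

section \<open>Entries of positive semidefinite matrices\<close>

lemma psd_mat_quadratic_form:
  assumes "psd_mat n A" and i: "i < n" and j: "j < n"
  shows "0 \<le> a\<^sup>2 * A $$ (i, i) + 2 * a * b * A $$ (i, j) + b\<^sup>2 * A $$ (j, j)"
proof -
  have A: "A \<in> carrier_mat n n" and sym: "transpose_mat A = A"
    and psd: "\<And>x. x \<in> carrier_vec n \<Longrightarrow> 0 \<le> x \<bullet> (A *\<^sub>v x)"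
    using assms(1) by (auto simp: psd_mat_def)
  have ji: "A $$ (j, i) = A $$ (i, j)"
    by (metis A carrier_matD i index_transpose_mat(1) j sym)
  define x where "x = a \<cdot>\<^sub>v unit_vec n i + b \<cdot>\<^sub>v unit_vec n j"
  have x: "x \<in> carrier_vec n"
    by (simp add: x_def)
  have u: "unit_vec n k \<bullet> (A *\<^sub>v unit_vec n l) = A $$ (k, l)" if "k < n" "l < n" for k l
    using A that by (simp add: scalar_prod_left_unit)
  \<comment> \<open>Symmetry merges the two mixed terms. The indices may coincide.\<close>
  have "x \<bullet> (A *\<^sub>v x) = a\<^sup>2 * A $$ (i, i) + 2 * a * b * A $$ (i, j) + b\<^sup>2 * A $$ (j, j)"
    using A i j unfolding x_def
    by (simp add: mult_add_distrib_mat_vec[of A n n] mult_mat_vec[of A n n]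
      add_scalar_prod_distrib[of _ n] scalar_prod_add_distrib[of _ n] u ji power2_eq_square algebra_simps)
  with psd[OF x] show ?thesis
    by simp
qed

lemma psd_mat_diag_nonneg:
  assumes "psd_mat n A" and "i < n"
  shows "0 \<le> A $$ (i, i)"
  using psd_mat_quadratic_form[OF assms assms(2), of 1 0] by simp

text \<open>Cauchy-Schwarz for the form of \<open>A\<close> on the span of two unit vectors. The
  argument divides by \<open>A $$ (j, j)\<close>, so the degenerate case is separate.\<close>

lemma psd_mat_entry_le:
  assumes psd: "psd_mat n A" and i: "i < n" and j: "j < n"
  shows "(A $$ (i, j))\<^sup>2 \<le> A $$ (i, i) * A $$ (j, j)"
proof (cases "A $$ (j, j) = 0")
  case True
  have "A $$ (i, j) = 0"
  proof (rule ccontr)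
    assume "A $$ (i, j) \<noteq> 0"
    \<comment> \<open>With \<open>A $$ (j, j) = 0\<close> and a = 1 the form is affine in b with
      nonzero slope. This b gives it the value -1.\<close>
    then have "2 * (- (A $$ (i, i) + 1) / (2 * A $$ (i, j))) * A $$ (i, j) = - (A $$ (i, i) + 1)"
      by simp
    then show False
      using psd_mat_quadratic_form[OF psd i j, of 1 "- (A $$ (i, i) + 1) / (2 * A $$ (i, j))"] True
      by simp
  qed
  then show ?thesis
    using True by simp
next
  case False
  let ?d = "A $$ (j, j)"
  \<comment> \<open>At a = A_jj and b = -A_ij the form is A_jj times the 2 by 2 minor.\<close>
  have "0 \<le> ?d * (A $$ (i, i) * ?d - (A $$ (i, j))\<^sup>2)"
    using psd_mat_quadratic_form[OF psd i j, of ?d "- A $$ (i, j)"]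
    by (simp add: power2_eq_square algebra_simps)
  moreover have "0 < ?d"
    using psd_mat_diag_nonneg[OF psd j] False by simp
  ultimately show ?thesis
    by (simp add: zero_le_mult_iff)
qed

section \<open>A single round of rejection sampling\<close>

lemma measure_spmf_finite_support:
  assumes "set_spmf P \<subseteq> B" and "finite B"
  shows "measure (measure_spmf P) X = (\<Sum>x\<in>X \<inter> B. spmf P x)"
proof -
  have "measure (measure_spmf P) X = measure (measure_spmf P) (X \<inter> B)"
    using assms(1) by (intro measure_spmf.finite_measure_eq_AE) (auto simp: AE_measure_spmf_iff)
  also have "\<dots> = (\<Sum>x\<in>X \<inter> B. spmf P x)"
    using assms(2)
    by (subst measure_spmf.finite_measure_eq_sum_singleton) (auto simp: spmf_conv_measure_spmf)
  finally show ?thesis .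
qed

text \<open>\<open>None\<close> marks a rejected draw, not divergence, so \<open>weight_spmf\<close>
  of a round is its acceptance probability.\<close>

definition thinned_pmf :: "'a pmf \<Rightarrow> ('a \<Rightarrow> real) \<Rightarrow> 'a spmf" where
  "thinned_pmf P r = bind_pmf P (\<lambda>x. map_pmf (\<lambda>b. if b then Some x else None) (bernoulli_pmf (r x)))"

lemma set_thinned_pmf: "set_spmf (thinned_pmf P r) \<subseteq> set_pmf P"
  by (auto simp: thinned_pmf_def in_set_spmf split: if_splits)

text \<open>A draw different from \<open>y\<close> never yields \<open>y\<close>, whatever its
  acceptance probability. Hence the range condition concerns \<open>r y\<close> alone.\<close>

lemma spmf_thinned_pmf:
  assumes "0 \<le> r y" and "r y \<le> 1"
  shows "spmf (thinned_pmf P r) y = pmf P y * r y"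
proof -
  have "spmf (map_pmf (\<lambda>b. if b then Some x else None) (bernoulli_pmf (r x))) y
      = r y * indicator {y} x" for x
  proof (cases "x = y")
    case True
    then have "(\<lambda>b. if b then Some x else None) -` {Some y} = {True}"
      by (auto split: if_splits)
    with True assms show ?thesis
      by (simp add: pmf_map measure_pmf_single)
  next
    case False
    then have "(\<lambda>b. if b then Some x else None) -` {Some y} = {}"
      by (auto split: if_splits)
    with False show ?thesis
      by (simp add: pmf_map)
  qed
  then show ?thesis
    by (simp add: thinned_pmf_def pmf_bind measure_pmf_single)
qed

lemma pmf_diag_pmf:
  assumes "0 < (\<Sum>k<length d. (d ! k) powr (p / 2))"
  shows "pmf (diag_pmf p d) i = (if i < length d
     then (d ! i) powr (p / 2) / (\<Sum>k<length d. (d ! k) powr (p / 2)) else 0)"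
  unfolding diag_pmf_def
proof (rule pmf_embed_pmf)
  let ?S = "\<Sum>k<length d. (d ! k) powr (p / 2)"
  let ?f = "\<lambda>i. if i < length d then (d ! i) powr (p / 2) / ?S else 0"
  show "0 \<le> ?f i" for i
    using assms by simp
  have "(\<integral>\<^sup>+ i. ennreal (?f i) \<partial>count_space UNIV) = (\<Sum>i<length d. ennreal (?f i))"
    by (rule nn_integral_count_space') auto
  also have "\<dots> = ennreal (\<Sum>i<length d. ?f i)"
    using assms by (intro sum_ennreal) auto
  also have "(\<Sum>i<length d. ?f i) = (\<Sum>i<length d. (d ! i) powr (p / 2)) / ?S"
    unfolding sum_divide_distrib by (rule sum.cong) auto
  finally show "(\<integral>\<^sup>+ i. ennreal (?f i) \<partial>count_space UNIV) = 1"
    using assms by simp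
qed

text \<open>The two draws and the acceptance coin collapse into one thinned draw of a pair, which
  gives the recursion the shape of the general loop above.\<close>

lemma rejection_rounds_unfold:
  "rejection_rounds c entry p d q t =
     bind_pmf (thinned_pmf (pair_pmf (diag_pmf p d) (diag_pmf p d))
         (\<lambda>(i, j). \<bar>entry i j\<bar> powr p / ((d ! i) * (d ! j)) powr (p / 2)))
       (\<lambda>r. case r of
          None \<Rightarrow> rejection_rounds c entry p d (q + 1) (t + c)
        | Some (i, j) \<Rightarrow> return_spmf (Run i j (q + 1) (t + c)))"
  by (subst rejection_rounds.simps)
     (auto simp: thinned_pmf_def pair_pmf_def bind_assoc_pmf bind_return_pmf bind_map_pmf
       intro!: bind_pmf_cong)

section \<open>The round for a fixed matrix and exponent\<close>

context
  fixes n :: nat and A :: "real mat" and p :: real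
begin

definition diag_list :: "real list" where
  "diag_list = map (\<lambda>i. A $$ (i, i)) [0..<n]"

definition diag_sum :: real where
  "diag_sum = (\<Sum>k<n. A $$ (k, k) powr (p / 2))"

definition entry_sum :: real where
  "entry_sum = (\<Sum>k<n. \<Sum>l<n. \<bar>A $$ (k, l)\<bar> powr p)"

definition round_spmf :: "(nat \<times> nat) spmf" where
  "round_spmf = thinned_pmf (pair_pmf (diag_pmf p diag_list) (diag_pmf p diag_list))
     (\<lambda>(i, j). \<bar>A $$ (i, j)\<bar> powr p / ((diag_list ! i) * (diag_list ! j)) powr (p / 2))"

text \<open>The law of the pair in one round conditioned on acceptance.\<close>

definition accepted_spmf :: "(nat \<times> nat) spmf" where
  "accepted_spmf = scale_spmf (inverse (weight_spmf round_spmf)) round_spmf"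

context
  assumes psd: "psd_mat n A" and nonzero: "A \<noteq> 0\<^sub>m n n" and p_nonneg: "0 \<le> p"
begin

lemma psd_mat_dim: "A \<in> carrier_mat n n" "dim_row A = n" "dim_col A = n"
  using psd by (auto simp: psd_mat_def)

lemma psd_mat_sym: "i < n \<Longrightarrow> j < n \<Longrightarrow> A $$ (j, i) = A $$ (i, j)"
  using psd by (metis carrier_matD index_transpose_mat(1) psd_mat_def)

lemma diag_list_nth: "i < n \<Longrightarrow> diag_list ! i = A $$ (i, i)"
  and length_diag_list: "length diag_list = n"
  by (simp_all add: diag_list_def)

text \<open>Follows from Cauchy-Schwarz. It covers the pairs for which the acceptance ratio has a
  zero denominator.\<close>

lemma psd_mat_entry_zero:
  assumes "i < n" "j < n" and "A $$ (i, i) = 0 \<or> A $$ (j, j) = 0"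
  shows "A $$ (i, j) = 0"
  using psd_mat_entry_le[OF psd assms(1,2)] assms(3) by auto

text \<open>A zero diagonal would force every entry to vanish. The positive entry makes the diagonal
  weights normalisable.\<close>

lemma psd_mat_diag_pos: "\<exists>i<n. 0 < A $$ (i, i)"
proof (rule ccontr)
  assume "\<not> ?thesis"
  then have "A $$ (i, i) = 0" if "i < n" for i
    using psd_mat_diag_nonneg[OF psd that] that by force
  then have "A = 0\<^sub>m n n"
    using psd_mat_dim by (intro eq_matI) (auto intro: psd_mat_entry_zero)
  with nonzero show False
    by simp
qed

lemma psd_mat_dim_pos: "0 < n"
  using psd_mat_diag_pos by auto

lemma diag_sum_pos: "0 < diag_sum"
  using psd_mat_diag_pos unfolding diag_sum_def by (auto intro: sum_pos2)

text \<open>The Cauchy-Schwarz bound raised to the power p / 2, which is monotone as 0 \<le> p. It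
  makes the acceptance ratio a probability.\<close>

lemma psd_mat_entry_powr_le:
  assumes "i < n" "j < n"
  shows "\<bar>A $$ (i, j)\<bar> powr p \<le> (A $$ (i, i) * A $$ (j, j)) powr (p / 2)"
proof -
  have "\<bar>A $$ (i, j)\<bar> powr p = (\<bar>A $$ (i, j)\<bar> powr 2) powr (p / 2)"
    by (simp only: powr_powr) simp
  also have "\<bar>A $$ (i, j)\<bar> powr 2 = (A $$ (i, j))\<^sup>2"
    by (cases "A $$ (i, j) = 0") (simp_all add: powr_numeral)
  also have "\<dots> powr (p / 2) \<le> (A $$ (i, i) * A $$ (j, j)) powr (p / 2)"
    using psd_mat_entry_le[OF psd assms] p_nonneg by (intro powr_mono2) auto
  finally show ?thesis .
qed

text \<open>The diagonal factors of the two draws cancel the denominator of the acceptance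
  ratio.\<close>

lemma spmf_round_spmf:
  assumes i: "i < n" and j: "j < n"
  shows "spmf round_spmf (i, j) = \<bar>A $$ (i, j)\<bar> powr p / diag_sum\<^sup>2"
proof -
  let ?r = "\<bar>A $$ (i, j)\<bar> powr p / ((diag_list ! i) * (diag_list ! j)) powr (p / 2)"
  have r: "?r \<le> 1"
    using psd_mat_entry_powr_le[OF i j] i j by (auto simp: diag_list_nth divide_le_eq_1 order_less_le)
  have D: "pmf (diag_pmf p diag_list) k = A $$ (k, k) powr (p / 2) / diag_sum" if "k < n" for k
    using that diag_sum_pos by (subst pmf_diag_pmf) (simp_all add: diag_sum_def length_diag_list diag_list_nth)
  have "spmf round_spmf (i, j)
      = A $$ (i, i) powr (p / 2) / diag_sum * (A $$ (j, j) powr (p / 2) / diag_sum) * ?r"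
    unfolding round_spmf_def using r i j by (subst spmf_thinned_pmf) (simp_all add: pmf_pair D)
  also have "\<dots> = \<bar>A $$ (i, j)\<bar> powr p / diag_sum\<^sup>2"
  proof (cases "A $$ (i, i) = 0 \<or> A $$ (j, j) = 0")
    \<comment> \<open>Nothing can be cancelled here, but the entry is 0, and
      \<open>0 powr p = 0\<close>, also for p = 0, makes both sides vanish.\<close>
    case True
    with psd_mat_entry_zero[OF i j] show ?thesis
      by auto
  next
    case False
    then show ?thesis
      using i j psd_mat_diag_nonneg[OF psd i] psd_mat_diag_nonneg[OF psd j]
      by (simp add: diag_list_nth powr_mult power2_eq_square)
  qed
  finally show ?thesis .
qed

lemma set_round_spmf: "set_spmf round_spmf \<subseteq> {..<n} \<times> {..<n}"
proof -
  have "set_pmf (diag_pmf p diag_list) \<subseteq> {..<n}"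
    using diag_sum_pos by (auto simp: set_pmf_eq pmf_diag_pmf diag_sum_def length_diag_list diag_list_nth split: if_splits)
  then show ?thesis
    unfolding round_spmf_def using set_thinned_pmf by fastforce
qed

section \<open>The acceptance probability and its lower bound 1 / n\<close>

lemma weight_round_spmf: "weight_spmf round_spmf = entry_sum / diag_sum\<^sup>2"
proof -
  have "weight_spmf round_spmf = (\<Sum>x\<in>{..<n} \<times> {..<n}. spmf round_spmf x)"
    using measure_spmf_finite_support[OF set_round_spmf, of UNIV] by (simp add: weight_spmf_def)
  also have "\<dots> = (\<Sum>i<n. \<Sum>j<n. spmf round_spmf (i, j))"
    by (simp add: sum.cartesian_product)
  also have "\<dots> = entry_sum / diag_sum\<^sup>2"
    by (simp add: spmf_round_spmf entry_sum_def sum_divide_distrib)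
  finally show ?thesis .
qed

lemma diag_sum_squared_le: "diag_sum\<^sup>2 \<le> real n * entry_sum"
proof -
  have "(\<Sum>k<n. (A $$ (k, k) powr (p / 2))\<^sup>2) = (\<Sum>k<n. \<bar>A $$ (k, k)\<bar> powr p)"
    using psd_mat_diag_nonneg[OF psd]
    by (intro sum.cong) (auto simp: power2_eq_square simp flip: powr_add)
  \<comment> \<open>Row \<open>k\<close> of the double sum contains its diagonal term, and the other
    terms are nonnegative.\<close>
  also have "\<dots> \<le> entry_sum"
    unfolding entry_sum_def
    by (intro sum_mono) (auto intro: member_le_sum[of _ "{..<n}" "\<lambda>l. \<bar>A $$ (_, l)\<bar> powr p"])
  finally have "(\<Sum>k<n. (A $$ (k, k) powr (p / 2))\<^sup>2) * n \<le> entry_sum * n"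
    by (intro mult_right_mono) auto
  moreover have "diag_sum\<^sup>2 \<le> (\<Sum>k<n. (A $$ (k, k) powr (p / 2))\<^sup>2) * n"
    unfolding diag_sum_def using sum_squared_le_sum_of_squares[of _ "{..<n}"] by simp
  ultimately show ?thesis
    by (simp add: mult.commute)
qed

text \<open>The previous bound has a positive left side, so no nonzero entry has to be
  exhibited.\<close>

lemma entry_sum_pos: "0 < entry_sum"
  using diag_sum_squared_le diag_sum_pos psd_mat_dim_pos
  by (metis less_le_trans of_nat_0_less_iff zero_less_mult_pos zero_less_power)

lemma weight_round_spmf_bounds: "weight_spmf round_spmf \<in> {0<..1}" and weight_round_spmf_ge: "1 / real n \<le> weight_spmf round_spmf"
  using entry_sum_pos diag_sum_pos diag_sum_squared_le psd_mat_dim_pos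
  by (auto simp: weight_round_spmf field_simps weight_spmf_le_1[of round_spmf, unfolded weight_round_spmf])

section \<open>Distribution of the accepted pair and its marginals\<close>

lemma spmf_accepted_spmf:
  "i < n \<Longrightarrow> j < n \<Longrightarrow> spmf accepted_spmf (i, j) = \<bar>A $$ (i, j)\<bar> powr p / entry_sum"
  using entry_sum_pos diag_sum_pos by (simp add: accepted_spmf_def spmf_scale_spmf spmf_round_spmf weight_round_spmf)

lemma lossless_accepted_spmf: "lossless_spmf accepted_spmf"
  using weight_round_spmf_bounds by (simp add: accepted_spmf_def lossless_spmf_def weight_scale_spmf)

lemma set_accepted_spmf: "set_spmf accepted_spmf \<subseteq> {..<n} \<times> {..<n}"
  using weight_round_spmf_bounds set_round_spmf by (simp add: accepted_spmf_def)

lemma measure_accepted_spmf: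
  "measure (measure_spmf accepted_spmf) X = (\<Sum>x\<in>X \<inter> {..<n} \<times> {..<n}. spmf accepted_spmf x)"
  by (rule measure_spmf_finite_support[OF set_accepted_spmf]) simp

lemma sum_lp_power_cols: "(\<Sum>k<n. lp_power p (col A k)) = entry_sum"
  unfolding entry_sum_def lp_power_def by (intro sum.cong) (auto simp: psd_mat_dim psd_mat_sym)

text \<open>The marginal sums over row \<open>i\<close>, which symmetry turns into column
  \<open>i\<close>.\<close>

lemma spmf_fst_accepted:
  assumes "i < n"
  shows "spmf (map_spmf fst accepted_spmf) i = lp_power p (col A i) / entry_sum"
proof -
  have "fst -` {i} \<inter> {..<n} \<times> {..<n} = {i} \<times> {..<n}"
    using assms by auto
  then have "spmf (map_spmf fst accepted_spmf) i = (\<Sum>x\<in>{i} \<times> {..<n}. spmf accepted_spmf x)"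
    by (simp add: spmf_map measure_accepted_spmf)
  also have "\<dots> = (\<Sum>j<n. spmf accepted_spmf (i, j))"
    using sum.cartesian_product[of "\<lambda>i j. spmf accepted_spmf (i, j)" "{..<n}" "{i}"] by simp
  also have "\<dots> = lp_power p (col A i) / entry_sum"
    using assms psd_mat_dim by (simp add: spmf_accepted_spmf lp_power_def sum_divide_distrib psd_mat_sym)
  finally show ?thesis .
qed

lemma spmf_snd_accepted:
  assumes "j < n"
  shows "spmf (map_spmf snd accepted_spmf) j = lp_power p (col A j) / entry_sum"
proof -
  have "snd -` {j} \<inter> {..<n} \<times> {..<n} = {..<n} \<times> {j}"
    using assms by auto
  then have "spmf (map_spmf snd accepted_spmf) j = (\<Sum>x\<in>{..<n} \<times> {j}. spmf accepted_spmf x)"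
    by (simp add: spmf_map measure_accepted_spmf)
  also have "\<dots> = (\<Sum>i<n. spmf accepted_spmf (i, j))"
    using sum.cartesian_product[of "\<lambda>i j. spmf accepted_spmf (i, j)" "{j}" "{..<n}"] by simp
  also have "\<dots> = lp_power p (col A j) / entry_sum"
    using assms psd_mat_dim by (simp add: spmf_accepted_spmf lp_power_def sum_divide_distrib)
  finally show ?thesis .
qed

section \<open>The sampler as an independent pair of a rejection count and an accepted pair\<close>

lemma rejection_sampler_eq:
  "rejection_sampler s c A p =
     map_spmf (\<lambda>(k, i, j). Run i j (n + k + 1) (s * n + (k + 1) * c))
       (pair_spmf (spmf_of_pmf (geometric_pmf (weight_spmf round_spmf))) accepted_spmf)"
proof -
  \<comment> \<open>Both counters are functions of the number \<open>k\<close> of rejections so far,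
    so the state of the loop reduces to \<open>k\<close>.\<close>
  let ?F = "\<lambda>k. rejection_rounds c (\<lambda>i j. A $$ (i, j)) p diag_list (n + k) (s * n + k * c)"
  let ?g = "\<lambda>k (i, j). Run i j (n + k + 1) (s * n + (k + 1) * c)"
  have "?F k = bind_pmf round_spmf (\<lambda>r. case r of None \<Rightarrow> ?F (Suc k) | Some x \<Rightarrow> return_spmf (?g k x))" for k
    by (subst rejection_rounds_unfold, fold round_spmf_def)
       (auto intro!: bind_pmf_cong split: option.split simp: algebra_simps)
  \<comment> \<open>The query count alone recovers \<open>k\<close>, so this holds even for
    \<open>c = 0\<close>.\<close>
  moreover have "inj (\<lambda>(k, x). ?g k x)"
    by (auto simp: inj_on_def)
  ultimately have "?F 0 = map_spmf (\<lambda>(k, x). ?g k x)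
      (pair_spmf (spmf_of_pmf (geometric_pmf (weight_spmf round_spmf))) accepted_spmf)"
    unfolding accepted_spmf_def using weight_round_spmf_bounds
    by (intro rejection_loop_eq[where F = ?F and g = ?g]) auto
  then show ?thesis
    by (simp add: rejection_sampler_def Let_def psd_mat_dim length_diag_list flip: diag_list_def)
qed

lemma lossless_rejection_sampler: "lossless_spmf (rejection_sampler s c A p)"
  using lossless_accepted_spmf by (simp add: rejection_sampler_eq lossless_spmf_def)

lemma map_rejection_sampler_pair:
  "map_spmf (\<lambda>r. (run_I r, run_J r)) (rejection_sampler s c A p) = accepted_spmf"
proof -
  have "map_spmf (\<lambda>r. (run_I r, run_J r)) (rejection_sampler s c A p)
      = map_spmf snd (pair_spmf (spmf_of_pmf (geometric_pmf (weight_spmf round_spmf))) accepted_spmf)"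
    unfolding rejection_sampler_eq spmf.map_comp by (rule map_spmf_cong) auto
  then show ?thesis
    by simp
qed

lemma map_rejection_sampler_cost:
  "map_spmf (\<lambda>r. (run_queries r, run_ops r)) (rejection_sampler s c A p) =
     map_spmf (\<lambda>k. (n + k + 1, s * n + (k + 1) * c)) (spmf_of_pmf (geometric_pmf (weight_spmf round_spmf)))"
proof -
  have "map_spmf (\<lambda>r. (run_queries r, run_ops r)) (rejection_sampler s c A p)
      = map_spmf (\<lambda>k. (n + k + 1, s * n + (k + 1) * c))
         (map_spmf fst (pair_spmf (spmf_of_pmf (geometric_pmf (weight_spmf round_spmf))) accepted_spmf))"
    unfolding rejection_sampler_eq spmf.map_comp by (rule map_spmf_cong) auto
  then show ?thesis
    using lossless_accepted_spmf by (simp add: lossless_spmf_def)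
qed

section \<open>Expected cost\<close>

lemma nn_integral_rejection_sampler_cost:
  "(\<integral>\<^sup>+ r. f (run_queries r) (run_ops r) \<partial>measure_spmf (rejection_sampler s c A p)) =
   (\<integral>\<^sup>+ k. f (n + k + 1) (s * n + (k + 1) * c) \<partial>measure_pmf (geometric_pmf (weight_spmf round_spmf)))"
  using arg_cong[OF map_rejection_sampler_cost[of s c],
      where f = "\<lambda>R. nn_integral (measure_spmf R) (\<lambda>(q, t). f q t)"]
  by (simp add: o_def)

lemma prob_rejection_sampler_cost:
  "measure (measure_spmf (rejection_sampler s c A p)) {r. P (run_queries r) (run_ops r)} =
   measure (measure_pmf (geometric_pmf (weight_spmf round_spmf))) {k. P (n + k + 1) (s * n + (k + 1) * c)}"
  using arg_cong[OF map_rejection_sampler_cost[of s c],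
      where f = "\<lambda>R. measure (measure_spmf R) {(q, t). P q t}"]
  by (simp add: measure_map_spmf vimage_def)

lemma inverse_weight_round_spmf_le: "1 / weight_spmf round_spmf \<le> real n"
  using weight_round_spmf_ge weight_round_spmf_bounds psd_mat_dim_pos by (simp add: field_simps)

lemma rejection_sampler_expected_queries:
  "(\<integral>\<^sup>+ r. ennreal (real (run_queries r)) \<partial>measure_spmf (rejection_sampler s c A p)) \<le> ennreal (2 * real n)"
proof -
  have "(\<integral>\<^sup>+ r. ennreal (real (run_queries r)) \<partial>measure_spmf (rejection_sampler s c A p))
      = (\<integral>\<^sup>+ k. ennreal (real n + 1 * (real k + 1)) \<partial>measure_pmf (geometric_pmf (weight_spmf round_spmf)))"
    by (subst nn_integral_rejection_sampler_cost[where f = "\<lambda>q _. ennreal (real q)"]) (simp add: algebra_simps)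
  also have "\<dots> = ennreal (real n + 1 / weight_spmf round_spmf)"
    using weight_round_spmf_bounds by (intro nn_integral_geometric_pmf) auto
  also have "\<dots> \<le> ennreal (2 * real n)"
    using inverse_weight_round_spmf_le by (intro ennreal_leI) simp
  finally show ?thesis .
qed

lemma rejection_sampler_expected_ops:
  "(\<integral>\<^sup>+ r. ennreal (real (run_ops r)) \<partial>measure_spmf (rejection_sampler s c A p))
     \<le> ennreal (real (s + c) * real n)"
proof -
  have "(\<integral>\<^sup>+ r. ennreal (real (run_ops r)) \<partial>measure_spmf (rejection_sampler s c A p))
      = (\<integral>\<^sup>+ k. ennreal (real (s * n) + real c * (real k + 1)) \<partial>measure_pmf (geometric_pmf (weight_spmf round_spmf)))"
    by (subst nn_integral_rejection_sampler_cost[where f = "\<lambda>_ t. ennreal (real t)"]) (simp add: algebra_simps)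
  also have "\<dots> = ennreal (real (s * n) + real c / weight_spmf round_spmf)"
    using weight_round_spmf_bounds by (intro nn_integral_geometric_pmf) auto
  also have "\<dots> \<le> ennreal (real (s + c) * real n)"
    using mult_left_mono[OF inverse_weight_round_spmf_le, of "real c"]
    by (intro ennreal_leI) (simp add: algebra_simps)
  finally show ?thesis .
qed

section \<open>Cost bounds with high probability\<close>

lemma rejection_sampler_tail_bound:
  assumes "0 < \<delta>" "\<delta> < 1" and C: "real s * real n + real c * (real n * ln (1 / \<delta>) + 1) \<le> T"
  shows "1 - \<delta> \<le> measure (measure_spmf (rejection_sampler s c A p))
    {r. int (run_queries r) \<le> int n + \<lceil>real n * ln (1 / \<delta>)\<rceil> \<and> real (run_ops r) \<le> T}"
proof -
  let ?a = "weight_spmf round_spmf"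
  \<comment> \<open>Both bounds are read off the single event of fewer than \<open>m\<close>
    rejections, so they hold jointly. The ceiling costs at most one extra round, the +1 in the
    hypothesis on \<open>T\<close>.\<close>
  define m where "m = nat \<lceil>real n * ln (1 / \<delta>)\<rceil>"
  have ln: "0 < ln (1 / \<delta>)"
    using assms by simp
  then have pos: "0 < real n * ln (1 / \<delta>)"
    using psd_mat_dim_pos by simp
  then have int_m: "int m = \<lceil>real n * ln (1 / \<delta>)\<rceil>"
    unfolding m_def by simp
  then have m_ge: "real n * ln (1 / \<delta>) \<le> real m" and m_le: "real m \<le> real n * ln (1 / \<delta>) + 1"
    by linarith+
  have "(1 - ?a) ^ m \<le> exp (- ?a) ^ m"
    using exp_ge_add_one_self[of "- ?a"] weight_round_spmf_bounds by (intro power_mono) auto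
  also have "\<dots> = exp (- (?a * real m))"
    by (simp add: mult.commute flip: exp_of_nat_mult)
  also have "\<dots> \<le> exp (- ln (1 / \<delta>))"
  proof -
    have "ln (1 / \<delta>) \<le> 1 / real n * real m"
      using m_ge psd_mat_dim_pos by (simp add: field_simps)
    also have "\<dots> \<le> ?a * real m"
      by (intro mult_right_mono weight_round_spmf_ge) simp
    finally show ?thesis
      by simp
  qed
  also have "\<dots> = \<delta>"
    using assms by (simp add: exp_minus)
  finally have "1 - \<delta> \<le> 1 - (1 - ?a) ^ m"
    by simp
  also have "\<dots> = measure (measure_pmf (geometric_pmf ?a)) {..<m}"
    using weight_round_spmf_bounds by (simp add: measure_geometric_pmf_lessThan)
  \<comment> \<open>Fewer than \<open>m\<close> rejections mean at most \<open>m\<close> rounds, the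
    accepting one included.\<close>
  also have "\<dots> \<le> measure (measure_pmf (geometric_pmf ?a))
     {k. int (n + k + 1) \<le> int n + \<lceil>real n * ln (1 / \<delta>)\<rceil> \<and> real (s * n + (k + 1) * c) \<le> T}"
  proof (intro measure_pmf.finite_measure_mono subsetI, clarify, intro conjI)
    fix k assume k: "k < m"
    then show "int (n + k + 1) \<le> int n + \<lceil>real n * ln (1 / \<delta>)\<rceil>"
      by (simp flip: int_m)
    have "(k + 1) * c \<le> m * c"
      using k by (intro mult_right_mono) auto
    then have "s * n + (k + 1) * c \<le> s * n + c * m"
      by (simp only: mult.commute[of c] add_le_cancel_left)
    then have "real (s * n + (k + 1) * c) \<le> real (s * n + c * m)"
      by (simp only: of_nat_le_iff)
    also have "\<dots> = real s * real n + real c * real m"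
      by simp
    also have "\<dots> \<le> real s * real n + real c * (real n * ln (1 / \<delta>) + 1)"
      using m_le by (intro add_left_mono mult_left_mono) auto
    finally show "real (s * n + (k + 1) * c) \<le> T"
      using C by simp
  qed auto
  also have "\<dots> = measure (measure_spmf (rejection_sampler s c A p))
    {r. int (run_queries r) \<le> int n + \<lceil>real n * ln (1 / \<delta>)\<rceil> \<and> real (run_ops r) \<le> T}"
    by (subst prob_rejection_sampler_cost[where P = "\<lambda>q t. int q \<le> int n + \<lceil>real n * ln (1 / \<delta>)\<rceil> \<and> real t \<le> T"]) simp
  finally show ?thesis .
qed

text \<open>The extra round from the ceiling costs c \<le> c n. The summand 1 beside the logarithm
  is kept because ln (1 / \<delta>) tends to 0 as \<delta> tends to 1, while the setup still costs s
  n.\<close>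

lemma rejection_sampler_tail_bound_one_plus_ln:
  assumes "0 < \<delta>" "\<delta> < 1"
  shows "1 - \<delta> \<le> measure (measure_spmf (rejection_sampler s c A p))
    {r. int (run_queries r) \<le> int n + \<lceil>real n * ln (1 / \<delta>)\<rceil> \<and>
        real (run_ops r) \<le> real (s + c) * (real n * (1 + ln (1 / \<delta>)))}"
proof (rule rejection_sampler_tail_bound[OF assms])
  have "0 \<le> ln (1 / \<delta>)" and n: "1 \<le> real n"
    using assms psd_mat_dim_pos by auto
  then have "0 \<le> real s * (real n * ln (1 / \<delta>))" and "real c * 1 \<le> real c * real n"
    by (simp, intro mult_left_mono, auto)
  then show "real s * real n + real c * (real n * ln (1 / \<delta>) + 1)
      \<le> real (s + c) * (real n * (1 + ln (1 / \<delta>)))"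
    by (simp add: algebra_simps)
qed

text \<open>For \<delta> bounded away from 1, the quotient of \<open>ln (1 / \<delta>)\<close> by
  \<open>ln (1 / \<delta>\<^sub>0)\<close> is at least 1 and absorbs the summand 1 of the previous
  bound. This is the origin of the constant.\<close>

lemma rejection_sampler_tail_bound_ln:
  assumes "0 < \<delta>" "\<delta> \<le> \<delta>\<^sub>0" "\<delta>\<^sub>0 < 1"
  shows "1 - \<delta> \<le> measure (measure_spmf (rejection_sampler s c A p))
    {r. int (run_queries r) \<le> int n + \<lceil>real n * ln (1 / \<delta>)\<rceil> \<and>
        real (run_ops r) \<le> real (s + c) * (1 / ln (1 / \<delta>\<^sub>0) + 1) * (real n * ln (1 / \<delta>))}"
proof -
  have "\<delta> < 1" and l0: "0 < ln (1 / \<delta>\<^sub>0)" and "ln (1 / \<delta>\<^sub>0) \<le> ln (1 / \<delta>)"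
    using assms by (auto simp: field_simps)
  then have "1 + ln (1 / \<delta>) \<le> (1 / ln (1 / \<delta>\<^sub>0) + 1) * ln (1 / \<delta>)"
    by (simp add: field_simps)
  then have "real (s + c) * (real n * (1 + ln (1 / \<delta>)))
      \<le> real (s + c) * (real n * ((1 / ln (1 / \<delta>\<^sub>0) + 1) * ln (1 / \<delta>)))"
    by (intro mult_left_mono) auto
  also have "\<dots> = real (s + c) * (1 / ln (1 / \<delta>\<^sub>0) + 1) * (real n * ln (1 / \<delta>))"
    by (simp only: mult_ac)
  finally have le: "real (s + c) * (real n * (1 + ln (1 / \<delta>))) \<le> \<dots>" .
  show ?thesis
    using rejection_sampler_tail_bound_one_plus_ln[OF assms(1) \<open>\<delta> < 1\<close>, of s c]
    by (rule order_trans, intro measure_spmf.finite_measure_mono) (use le in auto)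
qed

end

end

section \<open>The components of the theorem, with constants uniform in the matrix\<close>

lemma rejection_sampler_correct:
  fixes n :: nat and A :: "real mat" and p :: real
  assumes "0 \<le> p" "psd_mat n A" "A \<noteq> 0\<^sub>m n n"
  shows "let R = rejection_sampler s c A p in
      lossless_spmf R \<and>
      (\<forall>i<n. \<forall>j<n. spmf (map_spmf (\<lambda>r. (run_I r, run_J r)) R) (i, j)
          = \<bar>A $$ (i, j)\<bar> powr p / (\<Sum>k<n. \<Sum>l<n. \<bar>A $$ (k, l)\<bar> powr p)) \<and>
      (\<forall>i<n. spmf (map_spmf run_I R) i
          = lp_power p (col A i) / (\<Sum>k<n. lp_power p (col A k))) \<and>
      (\<forall>j<n. spmf (map_spmf run_J R) j
          = lp_power p (col A j) / (\<Sum>k<n. lp_power p (col A k))) \<and>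
      (\<integral>\<^sup>+ r. ennreal (real (run_queries r)) \<partial>measure_spmf R) \<le> ennreal (2 * real n)"
proof -
  note A = assms(2,3,1)
  let ?R = "rejection_sampler s c A p"
  have "map_spmf run_I ?R = map_spmf fst (accepted_spmf n A p)"
    and "map_spmf run_J ?R = map_spmf snd (accepted_spmf n A p)"
    unfolding map_rejection_sampler_pair[OF A, of s c, symmetric] by (simp_all add: spmf.map_comp o_def)
  then show ?thesis
    using lossless_rejection_sampler[OF A, of s c] rejection_sampler_expected_queries[OF A, of s c]
    by (simp add: Let_def map_rejection_sampler_pair[OF A] spmf_accepted_spmf[OF A]
      spmf_fst_accepted[OF A] spmf_snd_accepted[OF A] sum_lp_power_cols[OF A] entry_sum_def)
qed

lemma rejection_sampler_expected_ops_linear: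
  "\<exists>C::real. \<forall>(n::nat) (A::real mat) (p::real).
     0 \<le> p \<longrightarrow> psd_mat n A \<longrightarrow> A \<noteq> 0\<^sub>m n n \<longrightarrow>
     (\<integral>\<^sup>+ r. ennreal (real (run_ops r)) \<partial>measure_spmf (rejection_sampler s c A p))
       \<le> ennreal (C * real n)"
  by (intro exI[of _ "real (s + c)"] allI impI rejection_sampler_expected_ops)

lemma rejection_sampler_tail_linear_one_plus_ln:
  "\<exists>C::real. \<forall>(n::nat) (A::real mat) (p::real) (\<delta>::real).
     0 \<le> p \<longrightarrow> psd_mat n A \<longrightarrow> A \<noteq> 0\<^sub>m n n \<longrightarrow> 0 < \<delta> \<longrightarrow> \<delta> < 1 \<longrightarrow>
     1 - \<delta> \<le> measure (measure_spmf (rejection_sampler s c A p))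
       {r. int (run_queries r) \<le> int n + \<lceil>real n * ln (1 / \<delta>)\<rceil> \<and>
           real (run_ops r) \<le> C * (real n * (1 + ln (1 / \<delta>)))}"
  by (intro exI[of _ "real (s + c)"] allI impI rejection_sampler_tail_bound_one_plus_ln)

text \<open>The constant is uniform in n, A, p and \<delta> but depends on
  \<open>\<delta>\<^sub>0\<close>: its factor \<open>1 / ln (1 / \<delta>\<^sub>0)\<close> is
  unbounded as \<open>\<delta>\<^sub>0\<close> approaches 1.\<close>

lemma rejection_sampler_tail_linear_ln:
  assumes "\<delta>\<^sub>0 < 1"
  shows "\<exists>C::real. \<forall>(n::nat) (A::real mat) (p::real) (\<delta>::real).
       0 \<le> p \<longrightarrow> psd_mat n A \<longrightarrow> A \<noteq> 0\<^sub>m n n \<longrightarrow> 0 < \<delta> \<longrightarrow> \<delta> \<le> \<delta>\<^sub>0 \<longrightarrow>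
       1 - \<delta> \<le> measure (measure_spmf (rejection_sampler s c A p))
         {r. int (run_queries r) \<le> int n + \<lceil>real n * ln (1 / \<delta>)\<rceil> \<and>
             real (run_ops r) \<le> C * (real n * ln (1 / \<delta>))}"
  using assms
  by (intro exI[of _ "real (s + c) * (1 / ln (1 / \<delta>\<^sub>0) + 1)"] allI impI
    rejection_sampler_tail_bound_ln)

theorem theorem17:
  fixes s c :: nat
  shows
    "(\<forall>(n::nat) (A::real mat) (p::real). 0 \<le> p \<longrightarrow> psd_mat n A \<longrightarrow> A \<noteq> 0\<^sub>m n n \<longrightarrow>
       (let R = rejection_sampler s c A p in
        lossless_spmf R \<and>
        (\<forall>i<n. \<forall>j<n. spmf (map_spmf (\<lambda>r. (run_I r, run_J r)) R) (i, j)
            = \<bar>A $$ (i, j)\<bar> powr p / (\<Sum>k<n. \<Sum>l<n. \<bar>A $$ (k, l)\<bar> powr p)) \<and>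
        (\<forall>i<n. spmf (map_spmf run_I R) i
            = lp_power p (col A i) / (\<Sum>k<n. lp_power p (col A k))) \<and>
        (\<forall>j<n. spmf (map_spmf run_J R) j
            = lp_power p (col A j) / (\<Sum>k<n. lp_power p (col A k))) \<and>
        (\<integral>\<^sup>+ r. ennreal (real (run_queries r)) \<partial>measure_spmf R) \<le> ennreal (2 * real n)))
     \<and> (\<exists>C::real. \<forall>(n::nat) (A::real mat) (p::real).
         0 \<le> p \<longrightarrow> psd_mat n A \<longrightarrow> A \<noteq> 0\<^sub>m n n \<longrightarrow>
         (\<integral>\<^sup>+ r. ennreal (real (run_ops r)) \<partial>measure_spmf (rejection_sampler s c A p))
           \<le> ennreal (C * real n))
     \<and> (\<exists>C::real. \<forall>(n::nat) (A::real mat) (p::real) (\<delta>::real).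
         0 \<le> p \<longrightarrow> psd_mat n A \<longrightarrow> A \<noteq> 0\<^sub>m n n \<longrightarrow> 0 < \<delta> \<longrightarrow> \<delta> < 1 \<longrightarrow>
         1 - \<delta> \<le> measure (measure_spmf (rejection_sampler s c A p))
           {r. int (run_queries r) \<le> int n + \<lceil>real n * ln (1 / \<delta>)\<rceil> \<and>
               real (run_ops r) \<le> C * (real n * (1 + ln (1 / \<delta>)))})
     \<and> (\<forall>\<delta>\<^sub>0::real. 0 < \<delta>\<^sub>0 \<longrightarrow> \<delta>\<^sub>0 < 1 \<longrightarrow>
         (\<exists>C::real. \<forall>(n::nat) (A::real mat) (p::real) (\<delta>::real).
           0 \<le> p \<longrightarrow> psd_mat n A \<longrightarrow> A \<noteq> 0\<^sub>m n n \<longrightarrow> 0 < \<delta> \<longrightarrow> \<delta> \<le> \<delta>\<^sub>0 \<longrightarrow>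
           1 - \<delta> \<le> measure (measure_spmf (rejection_sampler s c A p))
             {r. int (run_queries r) \<le> int n + \<lceil>real n * ln (1 / \<delta>)\<rceil> \<and>
                 real (run_ops r) \<le> C * (real n * ln (1 / \<delta>))}))"
  by (intro conjI allI impI rejection_sampler_correct rejection_sampler_expected_ops_linear
    rejection_sampler_tail_linear_one_plus_ln rejection_sampler_tail_linear_ln)

end
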